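(* For every $n\ge0$, $$n!\,Z_{\delta_n}(t,-u)\in\mathbb N[t,u].$$ Equivalently, whenever $[t^iq^j]\,n!\,Z_{\delta_n}(t,q)\ne0$, its sign is $(-1)^j$.
   Context: $\mathbb N$ includes $0$. For $m\ge0$ put $m^+=\lceil m/2\rceil$, $m^-=\lfloor m/2\rfloor$ and $$\mathsf h_m(t,q)=\frac1{m!}\prod_{i=1}^{m^-}(t+i)\prod_{j=0}^{m^+-1}(t+jq),\qquad \mathsf h_0=1.$$ A composition $\alpha\models n$ is a finite sequence of positive integers with sum $n$ (the empty composition is the composition of $0$), with length $\ell(\alpha)$. A coarsening of $\alpha$ is a composition obtained by repeatedly replacing adjacent parts by their sum ($\alpha$ itself included); $\operatorname{Coars}(\alpha)$ is the set of coarsenings. In the algebra of noncommutative symmetric functions $\mathbb Q[t,q]\langle H_1,H_2,\dots\rangle$ let $H_\gamma=H_{\gamma_1}H_{\gamma_2}\cdots$ and $R_\alpha=\sum_{\gamma\in\operatorname{Coars}(\alpha)}(-1)^{\ell(\alpha)-\ell(\gamma)}H_\gamma$, $R_\varnothing=1$; let $\phi_{t,q}$ be the unital $\mathbb Q[t,q]$-algebra homomorphism to $\mathbb Q[t,q]$ with $H_m\mapsto\mathsf h_m(t,q)$, and $Z_\alpha(t,q)=\phi_{t,q}(R_\alpha)$. Explicitly, $$Z_\alpha(t,q)=\sum_{\gamma\in\operatorname{Coars}(\alpha)}(-1)^{\ell(\alpha)-\ell(\gamma)}\prod_{j=1}^{\ell(\gamma)}\mathsf h_{\gamma_j}(t,q),\qquad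 Z_\varnothing=1.$$ The zigzag compositions are $\delta_0=\varnothing$, $\delta_{2N}=(2,\dots,2)$ ($N$ parts), $\delta_{2N+1}=(2,\dots,2,1)$ ($N$ twos followed by a $1$). *)

theory Defs
  imports
    "HOL-Computational_Algebra.Polynomial"
    "HOL-Library.Poly_Mapping"
begin

text \<open>
  The ring Q[t,q] is represented as Q[q][t]: the outer polynomial variable is t, the inner one is q,
  so the coefficient of \<open>t^i q^j\<close> in \<open>p\<close> is \<open>coeff (coeff p i) j\<close>.
\<close>

type_synonym tq_poly = "rat poly poly"

definition var_t :: tq_poly where
  "var_t = [:0, 1:]"

definition var_q :: tq_poly where
  "var_q = [:[:0, 1:]:]"

definition tq_coeff :: "tq_poly \<Rightarrow> nat \<Rightarrow> nat \<Rightarrow> rat" where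
  "tq_coeff p i j = coeff (coeff p i) j"

text \<open>The substitution q := -u; the inner variable of the result plays the role of u.\<close>

definition subst_neg :: "tq_poly \<Rightarrow> tq_poly" where
  "subst_neg p = map_poly (\<lambda>c. pcompose c [:0, -1:]) p"

definition nat_coeff_polys :: "tq_poly set" where
  "nat_coeff_polys = {p. \<forall>i j. tq_coeff p i j \<in> \<nat>}"

text \<open>In \<open>hh m\<close>, \<open>\<lceil>m/2\<rceil> = (m + 1) div 2\<close> and \<open>\<lfloor>m/2\<rfloor> = m div 2\<close>.\<close>

definition hh :: "nat \<Rightarrow> tq_poly" where
  "hh m = [:[:1 / fact m:]:] *
     ((\<Prod>i = 1..m div 2. var_t + of_nat i) * (\<Prod>j < (m + 1) div 2. var_t + of_nat j * var_q))"


typedef composition = "{xs :: nat list. \<forall>x \<in> set xs. 0 < x}"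
  morphisms parts Composition
  by (rule exI[of _ "[]"]) simp

setup_lifting type_definition_composition

text \<open>Addition of compositions is concatenation, so that they form the free monoid on the
  positive integers.\<close>

instantiation composition :: monoid_add
begin

lift_definition zero_composition :: composition is "[]" by simp

lift_definition plus_composition :: "composition \<Rightarrow> composition \<Rightarrow> composition" is "(@)" by auto

instance by standard (transfer; simp)+

end

definition comp_length :: "composition \<Rightarrow> nat" where
  "comp_length \<alpha> = length (parts \<alpha>)"

inductive merge_adjacent :: "composition \<Rightarrow> composition \<Rightarrow> bool" where
  "parts \<alpha> = xs @ a # b # ys \<Longrightarrow> parts \<beta> = xs @ (a + b) # ys \<Longrightarrow> merge_adjacent \<alpha> \<beta>"

definition Coars :: "composition \<Rightarrow> composition set" where
  "Coars \<alpha> = {\<gamma>. merge_adjacent\<^sup>*\<^sup>* \<alpha> \<gamma>}"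

lift_definition zigzag :: "nat \<Rightarrow> composition"
  is "\<lambda>n. replicate (n div 2) 2 @ (if odd n then [1] else [])"
  by auto


text \<open>
  The free algebra \<open>Q[t,q]\<langle>H_1, H_2, \<dots>\<rangle>\<close> is the monoid algebra of the free monoid of compositions:
  multiplication in \<^typ>\<open>composition \<Rightarrow>\<^sub>0 tq_poly\<close> is convolution along concatenation. Scalars \<open>c\<close>
  are embedded as \<open>Poly_Mapping.single 0 c\<close>.
\<close>

type_synonym nsym = "composition \<Rightarrow>\<^sub>0 tq_poly"

text \<open>\<open>H_gen\<close> is only used at positive arguments; \<open>H_gen 0\<close> follows the convention \<open>H_0 = 1\<close>.\<close>

definition H_gen :: "nat \<Rightarrow> nsym" where
  "H_gen m = (if m = 0 then 1 else Poly_Mapping.single (Composition [m]) 1)"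

definition H_comp :: "composition \<Rightarrow> nsym" where
  "H_comp \<gamma> = prod_list (map H_gen (parts \<gamma>))"

definition R_comp :: "composition \<Rightarrow> nsym" where
  "R_comp \<alpha> = (\<Sum>\<gamma> \<in> Coars \<alpha>. (-1) ^ (comp_length \<alpha> - comp_length \<gamma>) * H_comp \<gamma>)"

text \<open>
  \<open>phi\<close> is defined on the monomial basis; the lemmas below confirm that it is the unital
  algebra homomorphism with \<open>phi (H_gen m) = hh m\<close>.
\<close>

definition phi :: "nsym \<Rightarrow> tq_poly" where
  "phi f = (\<Sum>\<gamma> \<in> Poly_Mapping.keys f.
     Poly_Mapping.lookup f \<gamma> * prod_list (map hh (parts \<gamma>)))"

definition Z :: "composition \<Rightarrow> tq_poly" where
  "Z \<alpha> = phi (R_comp \<alpha>)"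


lemma parts_zero [simp]: "parts 0 = []"
  by (rule zero_composition.rep_eq)

lemma parts_plus [simp]: "parts (\<alpha> + \<beta>) = parts \<alpha> @ parts \<beta>"
  by (rule plus_composition.rep_eq)

lemma phi_superset:
  assumes "finite A" "Poly_Mapping.keys f \<subseteq> A"
  shows "phi f = (\<Sum>\<gamma> \<in> A. Poly_Mapping.lookup f \<gamma> * prod_list (map hh (parts \<gamma>)))"
  unfolding phi_def using assms
  by (intro sum.mono_neutral_left) (auto simp: in_keys_iff)

lemma phi_add: "phi (f + g) = phi f + phi g"
proof -
  let ?A = "Poly_Mapping.keys f \<union> Poly_Mapping.keys g"
  have "Poly_Mapping.keys (f + g) \<subseteq> ?A" by (rule Poly_Mapping.keys_add)
  then show ?thesis
    by (simp add: phi_superset[of ?A] lookup_add distrib_right sum.distrib)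
qed

lemma phi_zero: "phi 0 = 0"
  by (simp add: phi_def)

lemma phi_sum: "phi (\<Sum>x \<in> A. F x) = (\<Sum>x \<in> A. phi (F x))"
  by (induction A rule: infinite_finite_induct) (simp_all add: phi_zero phi_add)

lemma phi_single: "phi (Poly_Mapping.single \<gamma> c) = c * prod_list (map hh (parts \<gamma>))"
  by (cases "c = 0") (simp_all add: phi_def)

lemma phi_scalar: "phi (Poly_Mapping.single 0 c) = c"
  by (simp add: phi_single)

lemma phi_one: "phi 1 = 1"
  using phi_scalar[of 1] by (simp add: single_one)

lemma phi_mult: "phi (f * g) = phi f * phi g"
proof -
  let ?s = "\<lambda>(h::nsym) k. Poly_Mapping.single k (Poly_Mapping.lookup h k)"
  have dec: "h = (\<Sum>k \<in> Poly_Mapping.keys h. ?s h k)" for h :: nsym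
    by (rule poly_mapping_eqI)
      (auto simp: lookup_sum lookup_single when_def in_keys_iff)
  have "phi (f * g) = phi ((\<Sum>k \<in> Poly_Mapping.keys f. ?s f k) * (\<Sum>l \<in> Poly_Mapping.keys g. ?s g l))"
    using dec[of f] dec[of g] by simp
  also have "\<dots> = (\<Sum>k \<in> Poly_Mapping.keys f. \<Sum>l \<in> Poly_Mapping.keys g. phi (?s f k) * phi (?s g l))"
    by (simp add: sum_product phi_sum mult_single phi_single mult_ac)
  also have "\<dots> = phi f * phi g"
    by (simp add: sum_product phi_def[of f] phi_def[of g] phi_single)
  finally show ?thesis .
qed

lemma phi_H_gen: "phi (H_gen m) = hh m"
proof (cases "m = 0")
  case True
  then show ?thesis by (simp add: H_gen_def phi_one hh_def one_pCons)
next
  case False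
  then show ?thesis by (simp add: H_gen_def phi_single Composition_inverse)
qed

lemma phi_H_comp: "phi (H_comp \<gamma>) = prod_list (map hh (parts \<gamma>))"
proof -
  have "phi (prod_list (map H_gen xs)) = prod_list (map hh xs)" for xs
    by (induction xs) (simp_all add: phi_one phi_mult phi_H_gen)
  then show ?thesis by (simp add: H_comp_def)
qed

lemma phi_minus_one_power: "phi ((-1) ^ k) = (-1) ^ k"
proof (induction k)
  case 0
  show ?case by (simp add: phi_one)
next
  case (Suc k)
  have "phi (-1) + phi 1 = 0" using phi_add[of "-1" 1] by (simp add: phi_zero)
  then have "phi (-1) = -1" by (simp add: phi_one eq_neg_iff_add_eq_0)
  with Suc show ?case by (simp only: power_Suc phi_mult)
qed

lemma Z_explicit:
  "Z \<alpha> = (\<Sum>\<gamma> \<in> Coars \<alpha>. (-1) ^ (comp_length \<alpha> - comp_length \<gamma>) * prod_list (map hh (parts \<gamma>)))"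
  by (simp only: Z_def R_comp_def phi_sum phi_mult phi_minus_one_power phi_H_comp)

lemma Coars_sum_length:
  assumes "\<gamma> \<in> Coars \<alpha>"
  shows "sum_list (parts \<gamma>) = sum_list (parts \<alpha>)" "comp_length \<gamma> \<le> comp_length \<alpha>"
proof -
  have "merge_adjacent\<^sup>*\<^sup>* \<alpha> \<gamma>" using assms by (simp add: Coars_def)
  then have "sum_list (parts \<gamma>) = sum_list (parts \<alpha>) \<and> comp_length \<gamma> \<le> comp_length \<alpha>"
    by (induction rule: rtranclp_induct) (auto elim!: merge_adjacent.cases simp: comp_length_def)
  then show "sum_list (parts \<gamma>) = sum_list (parts \<alpha>)" "comp_length \<gamma> \<le> comp_length \<alpha>"
    by simp_all
qed

lemma finite_Coars: "finite (Coars \<alpha>)"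
proof (rule finite_imageD)
  let ?B = "{xs. set xs \<subseteq> {..sum_list (parts \<alpha>)} \<and> length xs \<le> comp_length \<alpha>}"
  have "parts ` Coars \<alpha> \<subseteq> ?B"
    using Coars_sum_length member_le_sum_list by (fastforce simp: comp_length_def)
  then show "finite (parts ` Coars \<alpha>)"
    using finite_lists_length_le[of "{..sum_list (parts \<alpha>)}"] finite_subset by blast
  show "inj_on parts (Coars \<alpha>)"
    by (simp add: inj_on_def parts_inject)
qed

lemma Coars_zero: "Coars 0 = {0}"
proof -
  have "\<gamma> = 0" if "\<gamma> \<in> Coars 0" for \<gamma>
    using Coars_sum_length(2)[OF that] parts_inject[of \<gamma> 0] by (simp add: comp_length_def)
  then show ?thesis by (auto simp: Coars_def)
qed

lemma Z_zero: "Z 0 = 1"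
  by (simp add: Z_explicit Coars_zero comp_length_def)

lemma coeff_subst_neg: "tq_coeff (subst_neg p) i j = (-1) ^ j * tq_coeff p i j"
proof -
  have "coeff (pcompose c [:0, -1:]) j = (-1) ^ j * coeff c j" for c :: "rat poly" and j
  proof (induction c arbitrary: j rule: pCons_induct)
    case 0
    then show ?case by simp
  next
    case (pCons a c)
    then show ?case by (cases j) (simp_all add: pcompose_pCons)
  qed
  then show ?thesis by (simp add: subst_neg_def tq_coeff_def coeff_map_poly)
qed

end

theory Submission
  imports Defs "HOL-Computational_Algebra.Formal_Power_Series"
begin

text \<open>
  Put \<open>S(y) = \<Sum>N. Z(2\<^sup>N) y\<^sup>N\<close> and \<open>T(y) = \<Sum>N. Z(2\<^sup>N,1) y\<^sup>N\<close>, where \<open>2\<^sup>N\<close> stands for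
  \<open>N\<close> parts equal to \<open>2\<close>. Splitting off the first part of a
  coarsening shows that \<open>S = 1/E\<close> and \<open>T = O/E\<close>, where \<open>E(y) = \<Sum>k. (-1)\<^sup>k h\<^bsub>2k\<^esub> y\<^sup>k\<close> and
  \<open>O(y) = \<Sum>k. (-1)\<^sup>k h\<^bsub>2k+1\<^esub> y\<^sup>k\<close>. So \<open>S\<close> and \<open>T\<close> are analogues of
  secant and tangent (\<open>ribbon_even_series\<close>, \<open>ribbon_odd_series\<close>).

  Here \<open>(m+1) h\<^bsub>m+1\<^esub>\<close> is \<open>h\<^bsub>m\<^esub>\<close> times a factor that is affine in \<open>m\<close>, separately for even and for odd
  \<open>m\<close>. Hence \<open>E\<close> and \<open>O\<close> are contiguous hypergeometric series, and they satisfy a linear system of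
  differential equations of first order. Therefore \<open>T\<close> satisfies the Riccati equation
  \<open>y(4 + qy) T' = 2t - (2 + q(t+1)y) T + ty T + (2t+1)y T\<^sup>2\<close>, and \<open>S\<close> satisfies
  \<open>(4 + qy) S' = S ((2t+1) T + t)\<close>. Comparing coefficients yields recurrences
  (\<open>tangent_recurrence\<close>, \<open>secant_recurrence\<close>) in which, after \<open>q = -u\<close>, every coefficient is a
  polynomial in \<open>t\<close> and \<open>u\<close> with nonnegative coefficients, apart from a positive integer factor on
  the left. So all coefficients of \<open>S\<close> and \<open>T\<close>
  have the sign pattern claimed.

  Integrality is a separate and easier matter: \<open>m! h\<^bsub>m\<^esub>\<close> has integer coefficients, and the factor
  \<open>n!\<close> distributes over the products in \<open>Z\<close> at the cost of multinomial coefficients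
  (\<open>fact_times_ribbon_integral\<close>).
\<close>

unbundle fps_syntax

section \<open>Ribbon recursion for alternating sums over coarsenings\<close>

inductive merge :: "nat list \<Rightarrow> nat list \<Rightarrow> bool" where
  "merge (xs @ a # b # ys) (xs @ (a + b) # ys)"

definition coarsenings :: "nat list \<Rightarrow> nat list set" where
  "coarsenings xs = {ys. merge\<^sup>*\<^sup>* xs ys}"

lemma merge_Cons: "merge xs ys \<Longrightarrow> merge (a # xs) (a # ys)"
  by (elim merge.cases) (metis append_Cons merge.intros)

lemma merge_Cons_cases:
  assumes "merge (a # xs) zs"
  obtains ys where "zs = a # ys" "merge xs ys"
  | c ys where "xs = c # ys" "zs = (a + c) # ys"
  using assms
proof (cases rule: merge.cases)
  case (1 us b c vs)
  then show ?thesis using that by (cases us) (auto intro: merge.intros)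
qed

lemma coarsenings_Cons: "ys \<in> coarsenings xs \<Longrightarrow> a # ys \<in> coarsenings (a # xs)"
  unfolding coarsenings_def mem_Collect_eq
  by (induction rule: rtranclp_induct) (auto intro: merge_Cons rtranclp.rtrancl_into_rtrancl)

text \<open>Adding a constant to the first part commutes with merging, so it maps coarsenings to
  coarsenings.\<close>

lemma coarsenings_add_hd:
  assumes "ys \<in> coarsenings (b # xs)"
  shows "\<exists>c ws. ys = c # ws \<and> b \<le> c \<and> (a + c) # ws \<in> coarsenings ((a + b) # xs)"
  using assms unfolding coarsenings_def mem_Collect_eq
proof (induction rule: rtranclp_induct)
  case base
  then show ?case by auto
next
  case (step ys zs)
  then obtain c ws where *: "ys = c # ws" "b \<le> c" "merge\<^sup>*\<^sup>* ((a + b) # xs) ((a + c) # ws)"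
    by auto
  from step(2)[unfolded *(1)] show ?case
  proof (cases rule: merge_Cons_cases)
    case (1 vs)
    then show ?thesis using * by (auto intro: merge_Cons rtranclp.rtrancl_into_rtrancl)
  next
    case (2 d vs)
    have "merge ((a + c) # ws) ((a + (c + d)) # vs)"
      using merge.intros[of "[]" "a + c" d vs] 2 by (simp add: add.assoc)
    then show ?thesis using * 2 by (auto intro: rtranclp.rtrancl_into_rtrancl)
  qed
qed

lemma coarsenings_Nil: "coarsenings [] = {[]}"
proof -
  have "ys = []" if "merge\<^sup>*\<^sup>* [] ys" for ys
    using that by (induction rule: rtranclp_induct) (auto elim: merge.cases)
  then show ?thesis by (auto simp: coarsenings_def)
qed

lemma coarsenings_singleton: "coarsenings [a] = {[a]}"
proof -
  have "ys = [a]" if "merge\<^sup>*\<^sup>* [a] ys" for ys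
    using that
    by (induction rule: rtranclp_induct) (auto elim: merge_Cons_cases merge.cases)
  then show ?thesis by (auto simp: coarsenings_def)
qed

text \<open>Either the first two parts stay separated for ever, or they may as well be merged first.\<close>

lemma coarsenings_Cons_Cons:
  "coarsenings (a # b # xs) = (#) a ` coarsenings (b # xs) \<union> coarsenings ((a + b) # xs)"
    (is "?L = ?R")
proof
  show "?L \<subseteq> ?R"
  proof
    fix ys assume "ys \<in> ?L"
    then have "merge\<^sup>*\<^sup>* (a # b # xs) ys" by (simp add: coarsenings_def)
    then show "ys \<in> ?R"
    proof (induction rule: rtranclp_induct)
      case base
      then show ?case by (simp add: coarsenings_def)
    next
      case (step ys zs)
      from step.IH show ?case
      proof
        assume "ys \<in> coarsenings ((a + b) # xs)"
        then show ?thesis using step(2)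
          by (auto simp: coarsenings_def intro: rtranclp.rtrancl_into_rtrancl)
      next
        assume "ys \<in> (#) a ` coarsenings (b # xs)"
        then obtain us where us: "ys = a # us" "us \<in> coarsenings (b # xs)" by auto
        from step(2)[unfolded us(1)] show ?thesis
        proof (cases rule: merge_Cons_cases)
          case (1 vs)
          then show ?thesis using us
            by (auto simp: coarsenings_def intro: rtranclp.rtrancl_into_rtrancl)
        next
          case (2 c vs)
          then show ?thesis using coarsenings_add_hd[OF us(2), of a] by auto
        qed
      qed
    qed
  qed
  have "merge (a # b # xs) ((a + b) # xs)"
    using merge.intros[of "[]" a b xs] by simp
  then show "?R \<subseteq> ?L"
    by (auto simp: coarsenings_Cons)
      (auto simp: coarsenings_def intro: converse_rtranclp_into_rtranclp)
qed

text \<open>The image of the ribbon function \<open>R\<close> under \<open>H\<^bsub>m\<^esub> \<mapsto> h m\<close>; the recursive equation is the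
  multiplication rule \<open>H\<^bsub>a\<^esub> R\<^bsub>b,xs\<^esub> = R\<^bsub>a,b,xs\<^esub> + R\<^bsub>a+b,xs\<^esub>\<close>.\<close>

fun ribbon :: "(nat \<Rightarrow> 'a::comm_ring_1) \<Rightarrow> nat list \<Rightarrow> 'a" where
  "ribbon h [] = 1"
| "ribbon h [a] = h a"
| "ribbon h (a # b # xs) = h a * ribbon h (b # xs) - ribbon h ((a + b) # xs)"

lemma finite_coarsenings: "finite (coarsenings xs)"
  \<comment> \<open>The function is arbitrary; only the recursion scheme on lists matters.\<close>
  by (induction "\<lambda>_::nat. 0::int" xs rule: ribbon.induct)
    (simp_all add: coarsenings_Nil coarsenings_singleton coarsenings_Cons_Cons)

lemma length_coarsenings: "ys \<in> coarsenings xs \<Longrightarrow> length ys \<le> length xs"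
  unfolding coarsenings_def mem_Collect_eq
  by (induction rule: rtranclp_induct) (auto elim: merge.cases)

lemma ribbon_eq_sum_coarsenings:
  assumes "\<forall>x\<in>set xs. 0 < x"
  shows "ribbon h xs =
    (\<Sum>ys\<in>coarsenings xs. (-1) ^ (length xs - length ys) * prod_list (map h ys))"
  using assms
proof (induction h xs rule: ribbon.induct)
  case (3 h a b xs)
  let ?f = "\<lambda>zs ys. (-1) ^ (length zs - length ys) * prod_list (map h ys)"
  \<comment> \<open>The union is disjoint because \<open>b > 0\<close>: the first part is \<open>a\<close> in the one set and at least
    \<open>a + b\<close> in the other.\<close>
  have disj: "(#) a ` coarsenings (b # xs) \<inter> coarsenings ((a + b) # xs) = {}"
    using coarsenings_add_hd[of _ "a + b" xs 0] 3(3) by fastforce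
  have "sum (?f (a # b # xs)) (coarsenings (a # b # xs)) =
      sum (?f (a # b # xs)) ((#) a ` coarsenings (b # xs)) +
      sum (?f (a # b # xs)) (coarsenings ((a + b) # xs))"
    unfolding coarsenings_Cons_Cons using disj
    by (intro sum.union_disjoint) (simp_all add: finite_coarsenings)
  also have "sum (?f (a # b # xs)) ((#) a ` coarsenings (b # xs)) =
      h a * sum (?f (b # xs)) (coarsenings (b # xs))"
    by (subst sum.reindex) (auto simp: sum_distrib_left mult_ac)
  also have "sum (?f (a # b # xs)) (coarsenings ((a + b) # xs)) =
      - sum (?f ((a + b) # xs)) (coarsenings ((a + b) # xs))"
    unfolding sum_negf[symmetric]
  proof (rule sum.cong)
    fix ys assume "ys \<in> coarsenings ((a + b) # xs)"
    then have "length ys \<le> Suc (length xs)" using length_coarsenings by fastforce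
    then show "?f (a # b # xs) ys = - ?f ((a + b) # xs) ys" by (simp add: Suc_diff_le)
  qed simp
  finally show ?case using 3 by simp
qed (simp_all add: coarsenings_Nil coarsenings_singleton)

lemma merge_adjacent_iff: "merge_adjacent \<alpha> \<beta> \<longleftrightarrow> merge (parts \<alpha>) (parts \<beta>)"
  by (auto simp: merge_adjacent.simps merge.simps)

lemma parts_image_Coars: "parts ` Coars \<alpha> = coarsenings (parts \<alpha>)"
proof
  have "merge\<^sup>*\<^sup>* (parts \<alpha>) (parts \<gamma>)" if "merge_adjacent\<^sup>*\<^sup>* \<alpha> \<gamma>" for \<gamma>
    using that by (induction rule: rtranclp_induct)
      (auto simp: merge_adjacent_iff intro: rtranclp.rtrancl_into_rtrancl)
  then show "parts ` Coars \<alpha> \<subseteq> coarsenings (parts \<alpha>)"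
    by (auto simp: Coars_def coarsenings_def)
  have "ys \<in> parts ` Coars \<alpha>" if "merge\<^sup>*\<^sup>* (parts \<alpha>) ys" for ys
    using that
  proof (induction rule: rtranclp_induct)
    case base
    then show ?case by (auto simp: Coars_def)
  next
    case (step ys zs)
    then obtain \<gamma> where \<gamma>: "ys = parts \<gamma>" "merge_adjacent\<^sup>*\<^sup>* \<alpha> \<gamma>" by (auto simp: Coars_def)
    have "\<forall>x\<in>set ys. 0 < x" using \<gamma> parts[of \<gamma>] by simp
    then have "\<forall>x\<in>set zs. 0 < x" using step(2) by (auto elim!: merge.cases)
    then have zs: "parts (Composition zs) = zs" by (simp add: Composition_inverse)
    then have "merge_adjacent \<gamma> (Composition zs)" using step(2) \<gamma> by (simp add: merge_adjacent_iff)
    then have "Composition zs \<in> Coars \<alpha>" using \<gamma> by (simp add: Coars_def)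
    then show ?case using zs by (metis imageI)
  qed
  then show "coarsenings (parts \<alpha>) \<subseteq> parts ` Coars \<alpha>" by (auto simp: coarsenings_def)
qed

lemma Z_eq_ribbon: "Z \<alpha> = ribbon hh (parts \<alpha>)"
proof -
  have "ribbon hh (parts \<alpha>) = (\<Sum>ys\<in>parts ` Coars \<alpha>.
      (-1) ^ (length (parts \<alpha>) - length ys) * prod_list (map hh ys))"
    using parts[of \<alpha>] by (simp add: ribbon_eq_sum_coarsenings parts_image_Coars)
  also have "\<dots> = Z \<alpha>"
    unfolding Z_explicit
    by (subst sum.reindex) (auto simp: inj_on_def parts_inject comp_length_def)
  finally show ?thesis by simp
qed


section \<open>Secant and tangent series of ribbons\<close>

lemma ribbon_Cons_twos:
  "ribbon h (a # replicate N 2 @ tail) =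
    (\<Sum>i<N. (-1) ^ i * h (a + 2 * i) * ribbon h (replicate (N - i) 2 @ tail)) +
    (-1) ^ N * ribbon h ((a + 2 * N) # tail)"
proof (induction N arbitrary: a)
  case (Suc N)
  show ?case using Suc[of "a + 2"]
    by (simp add: sum.lessThan_Suc_shift sum_negf algebra_simps del: sum.lessThan_Suc)
qed simp

text \<open>A leading part \<open>0\<close> makes the two terms of the recursion cancel, which turns the expansion of
  \<open>ribbon_Cons_twos\<close> into a linear relation between ribbons.\<close>

lemma ribbon_Cons_zero: "h 0 = 1 \<Longrightarrow> xs \<noteq> [] \<Longrightarrow> ribbon h (0 # xs) = 0"
  by (cases xs) simp_all

definition even_series :: "(nat \<Rightarrow> 'a::comm_ring_1) \<Rightarrow> 'a fps" where
  "even_series h = Abs_fps (\<lambda>k. (-1) ^ k * h (2 * k))"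

definition odd_series :: "(nat \<Rightarrow> 'a::comm_ring_1) \<Rightarrow> 'a fps" where
  "odd_series h = Abs_fps (\<lambda>k. (-1) ^ k * h (2 * k + 1))"

definition secant_series :: "(nat \<Rightarrow> 'a::comm_ring_1) \<Rightarrow> 'a fps" where
  "secant_series h = Abs_fps (\<lambda>N. ribbon h (replicate N 2))"

definition tangent_series :: "(nat \<Rightarrow> 'a::comm_ring_1) \<Rightarrow> 'a fps" where
  "tangent_series h = Abs_fps (\<lambda>N. ribbon h (replicate N 2 @ [1]))"

lemma ribbon_even_series:
  assumes "h 0 = 1"
  shows "even_series h * secant_series h = 1"
proof (rule fps_ext)
  fix N
  show "(even_series h * secant_series h) $ N = 1 $ N"
  proof (cases "N = 0")
    case True
    then show ?thesis using assms by (simp add: even_series_def secant_series_def)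
  next
    case False
    then have "ribbon h (0 # replicate N 2) = 0" using assms by (intro ribbon_Cons_zero) auto
    then show ?thesis using ribbon_Cons_twos[of h 0 N "[]"] False
      by (simp add: fps_mult_nth even_series_def secant_series_def atLeast0AtMost
        lessThan_Suc_atMost[symmetric])
  qed
qed

lemma ribbon_odd_series:
  assumes "h 0 = 1"
  shows "even_series h * tangent_series h = odd_series h"
proof (rule fps_ext)
  fix N
  have "ribbon h (0 # replicate N 2 @ [1]) = 0" using assms by (intro ribbon_Cons_zero) auto
  then show "(even_series h * tangent_series h) $ N = odd_series h $ N"
    using ribbon_Cons_twos[of h 0 N "[1]"]
    by (simp add: fps_mult_nth even_series_def tangent_series_def odd_series_def atLeast0AtMost
        lessThan_Suc_atMost[symmetric] algebra_simps)
qed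


section \<open>Differential equations and recurrences\<close>

lemma hh_0: "hh 0 = 1"
  by (simp add: hh_def one_pCons)

lemma scalar_Suc: "of_nat (Suc m) * [:[:1 / fact (Suc m) :: rat:]:] = [:[:1 / fact m:]:]"
  by (simp add: of_nat_poly del: of_nat_Suc)

lemma hh_odd: "of_nat (2 * k + 1) * hh (2 * k + 1) = (var_t + of_nat k * var_q) * hh (2 * k)"
proof -
  have "of_nat (2 * k + 1) * hh (2 * k + 1) = (of_nat (Suc (2*k)) * [:[:1 / fact (Suc (2*k)):]:]) *
     ((\<Prod>i = 1..k. var_t + of_nat i) * (\<Prod>j < Suc k. var_t + of_nat j * var_q))"
    by (simp add: hh_def del: of_nat_Suc fact_Suc mult_pCons_left mult_pCons_right)
  then show ?thesis unfolding scalar_Suc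
    by (simp add: hh_def mult_ac del: mult_pCons_left mult_pCons_right)
qed

lemma hh_even: "of_nat (2 * k + 2) * hh (2 * k + 2) = (var_t + of_nat k + 1) * hh (2 * k + 1)"
proof -
  have "of_nat (2 * k + 2) * hh (2 * k + 2) =
     (of_nat (Suc (2*k+1)) * [:[:1 / fact (Suc (2*k+1)):]:]) *
     ((\<Prod>i = 1..Suc k. var_t + of_nat i) * (\<Prod>j < Suc k. var_t + of_nat j * var_q))"
    by (simp add: hh_def del: of_nat_Suc fact_Suc mult_pCons_left mult_pCons_right
      prod.lessThan_Suc prod.cl_ivl_Suc)
  then show ?thesis unfolding scalar_Suc
    by (simp add: hh_def mult_ac add_ac del: mult_pCons_left mult_pCons_right)
qed

abbreviation "fps_t \<equiv> fps_const var_t"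
abbreviation "fps_q \<equiv> fps_const var_q"

text \<open>The next two identities are \<open>hh_odd\<close> and \<open>hh_even\<close> coefficientwise: the operator
  \<open>fps_X * fps_deriv\<close> multiplies the coefficient of \<open>y\<^sup>k\<close> by \<open>k\<close>, which accounts for every
  affine function of \<open>k\<close>.\<close>

lemma deriv_odd_series:
  "2 * fps_X * fps_deriv (odd_series hh) + odd_series hh =
   fps_t * even_series hh + fps_q * fps_X * fps_deriv (even_series hh)"
proof (rule fps_ext)
  fix n
  have "(2 * fps_X * fps_deriv (odd_series hh) + odd_series hh) $ n =
     (-1) ^ n * (of_nat (2 * n + 1) * hh (2 * n + 1))"
    by (cases n) (simp_all add: odd_series_def numeral_fps_const mult.assoc algebra_simps)
  also have "\<dots> = (fps_t * even_series hh + fps_q * fps_X * fps_deriv (even_series hh)) $ n"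
    unfolding hh_odd
    by (cases n) (simp_all add: even_series_def mult.assoc algebra_simps)
  finally show "(2 * fps_X * fps_deriv (odd_series hh) + odd_series hh) $ n =
    (fps_t * even_series hh + fps_q * fps_X * fps_deriv (even_series hh)) $ n" .
qed

lemma deriv_even_series:
  "2 * fps_deriv (even_series hh) =
   - ((fps_t + 1) * odd_series hh + fps_X * fps_deriv (odd_series hh))"
proof (rule fps_ext)
  fix n
  have "(2 * fps_deriv (even_series hh)) $ n = - ((-1) ^ n * (of_nat (2 * n + 2) * hh (2 * n + 2)))"
    by (simp add: even_series_def numeral_fps_const algebra_simps)
  also have "\<dots> = (- ((fps_t + 1) * odd_series hh + fps_X * fps_deriv (odd_series hh))) $ n"
    unfolding hh_even
    by (cases n) (simp_all add: odd_series_def algebra_simps)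
  finally show "(2 * fps_deriv (even_series hh)) $ n =
    (- ((fps_t + 1) * odd_series hh + fps_X * fps_deriv (odd_series hh))) $ n" .
qed

text \<open>The linear system solved for the derivatives.\<close>

lemma ode_even_series:
  "(4 + fps_q * fps_X) * fps_deriv (even_series hh) =
   - ((2 * fps_t + 1) * odd_series hh + fps_t * even_series hh)"
  using deriv_odd_series deriv_even_series by algebra

lemma ode_odd_series:
  "fps_X * (4 + fps_q * fps_X) * fps_deriv (odd_series hh) =
   2 * fps_t * even_series hh - (2 + fps_q * (fps_t + 1) * fps_X) * odd_series hh"
  using deriv_odd_series deriv_even_series by algebra

lemma even_series_nonzero: "even_series hh \<noteq> 0"
  using ribbon_even_series[of hh, OF hh_0] by auto

text \<open>The quotient of the two components of a solution of a linear system of first order always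
  satisfies a Riccati equation. It is obtained here without division: both sides are multiplied by
  \<open>E\<close>, the system is inserted, and \<open>E\<close> is cancelled.\<close>

lemma riccati_tangent_series:
  defines "T \<equiv> tangent_series hh"
  shows "fps_X * (4 + fps_q * fps_X) * fps_deriv T =
    2 * fps_t - (2 + fps_q * (fps_t + 1) * fps_X) * T + fps_t * fps_X * T
      + (2 * fps_t + 1) * fps_X * T ^ 2"
    (is "?l = ?r")
proof -
  let ?E = "even_series hh" and ?O = "odd_series hh"
  have ET: "?E * T = ?O" unfolding T_def by (rule ribbon_odd_series[of hh, OF hh_0])
  then have "fps_deriv ?O = ?E * fps_deriv T + fps_deriv ?E * T"
    by (metis fps_deriv_mult)
  then have "?E * ?l = ?E * ?r"
    using ET ode_even_series ode_odd_series by algebra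
  then show ?thesis using even_series_nonzero by simp
qed

lemma ode_secant_series:
  defines "S \<equiv> secant_series hh" and "T \<equiv> tangent_series hh"
  shows "(4 + fps_q * fps_X) * fps_deriv S = S * ((2 * fps_t + 1) * T + fps_t)"
    (is "?l = ?r")
proof -
  let ?E = "even_series hh" and ?O = "odd_series hh"
  have ET: "?E * T = ?O" unfolding T_def by (rule ribbon_odd_series[of hh, OF hh_0])
  have ES: "?E * S = 1" unfolding S_def by (rule ribbon_even_series[of hh, OF hh_0])
  then have "?E * fps_deriv S + fps_deriv ?E * S = 0"
    by (metis fps_deriv_mult fps_deriv_1)
  then have "?E * ?l = ?E * ?r"
    using ET ES ode_even_series by algebra
  then show ?thesis using even_series_nonzero by simp
qed

lemma fps_const_affine:
  "fps_const (var_t + 1) = fps_t + 1" "fps_const (2 * var_t + 1) = 2 * fps_t + 1"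
  by (simp_all add: numeral_fps_const flip: fps_const_add fps_const_mult)

text \<open>The derivative term contributes \<open>q n\<close> to the factor of the previous coefficient. On the
  right-hand side it becomes \<open>-q n = u n\<close>, the same sign as the contribution \<open>-q (t + 1)\<close> of the
  linear term, so both have nonnegative coefficients in \<open>t\<close> and \<open>u\<close>.\<close>

lemma tangent_recurrence:
  defines "T \<equiv> tangent_series hh"
  shows "of_nat (4 * n + 6) * T $ Suc n =
    - var_q * (var_t + of_nat (Suc n)) * T $ n + var_t * T $ n
      + (2 * var_t + 1) * (\<Sum>i\<le>n. T $ i * T $ (n - i))"
proof -
  have "fps_X * (4 * fps_deriv T + fps_q * (fps_X * fps_deriv T)) + 2 * T =
    2 * fps_t + fps_X * (- (fps_q * (fps_const (var_t + 1) * T)) + fps_t * T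
      + fps_const (2 * var_t + 1) * (T * T))"
    using riccati_tangent_series[folded T_def] unfolding fps_const_affine by algebra
  from this[THEN arg_cong[where f = "\<lambda>F. F $ Suc n"]]
  show ?thesis
    by (cases n) (simp_all add: numeral_fps_const fps_mult_nth[of T T] atLeast0AtMost,
        simp_all add: algebra_simps)
qed

lemma secant_recurrence:
  defines "S \<equiv> secant_series hh" and "T \<equiv> tangent_series hh"
  shows "of_nat (4 * Suc n) * S $ Suc n =
    - var_q * of_nat n * S $ n + var_t * S $ n
      + (2 * var_t + 1) * (\<Sum>i\<le>n. S $ i * T $ (n - i))"
proof -
  have "4 * fps_deriv S + fps_q * (fps_X * fps_deriv S) =
    fps_t * S + fps_const (2 * var_t + 1) * (S * T)"
    using ode_secant_series[folded S_def T_def] unfolding fps_const_affine by algebra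
  from this[THEN arg_cong[where f = "\<lambda>F. F $ n"]]
  show ?thesis
    by (cases n) (simp_all add: numeral_fps_const fps_mult_nth[of S T] atLeast0AtMost,
        simp_all add: algebra_simps)
qed


section \<open>The sign pattern\<close>

lemma tq_coeff_add: "tq_coeff (p + r) i j = tq_coeff p i j + tq_coeff r i j"
  by (simp add: tq_coeff_def)

lemma tq_coeff_diff: "tq_coeff (p - r) i j = tq_coeff p i j - tq_coeff r i j"
  by (simp add: tq_coeff_def)

lemma tq_coeff_mult:
  "tq_coeff (p * r) i j = (\<Sum>k\<le>i. \<Sum>l\<le>j. tq_coeff p k l * tq_coeff r (i - k) (j - l))"
  by (simp add: tq_coeff_def coeff_mult coeff_sum)

lemma tq_coeff_of_nat_mult: "tq_coeff (of_nat n * p) i j = of_nat n * tq_coeff p i j"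
  by (simp add: tq_coeff_def of_nat_poly)

lemma tq_coeff_fact_mult: "tq_coeff (fact n * p) i j = fact n * tq_coeff p i j"
  using tq_coeff_of_nat_mult[of "fact n"] by simp

text \<open>The polynomials that have nonnegative coefficients in \<open>t\<close> and \<open>u = -q\<close>.\<close>

definition sign_cone :: "tq_poly set" where
  "sign_cone = {p. \<forall>i j. 0 \<le> (-1) ^ j * tq_coeff p i j}"

lemma sign_cone_add: "p \<in> sign_cone \<Longrightarrow> r \<in> sign_cone \<Longrightarrow> p + r \<in> sign_cone"
  by (simp add: sign_cone_def tq_coeff_add distrib_left)

lemma sign_cone_mult:
  assumes "p \<in> sign_cone" "r \<in> sign_cone"
  shows "p * r \<in> sign_cone"
  unfolding sign_cone_def mem_Collect_eq
proof (intro allI)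
  fix i j
  have "(-1) ^ j * tq_coeff (p * r) i j = (\<Sum>k\<le>i. \<Sum>l\<le>j.
      ((-1) ^ l * tq_coeff p k l) * ((-1) ^ (j - l) * tq_coeff r (i - k) (j - l)))"
    unfolding tq_coeff_mult sum_distrib_left
  proof (intro sum.cong refl)
    fix k l assume "l \<in> {..j}"
    then have "(-1::rat) ^ j = (-1) ^ l * (-1) ^ (j - l)" by (simp flip: power_add)
    then show "(-1) ^ j * (tq_coeff p k l * tq_coeff r (i - k) (j - l)) =
      ((-1) ^ l * tq_coeff p k l) * ((-1) ^ (j - l) * tq_coeff r (i - k) (j - l))" by simp
  qed
  also have "\<dots> \<ge> 0"
    by (intro sum_nonneg, rule mult_nonneg_nonneg) (use assms in \<open>auto simp: sign_cone_def\<close>)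
  finally show "0 \<le> (-1) ^ j * tq_coeff (p * r) i j" .
qed

lemma sign_cone_of_nat: "of_nat n \<in> sign_cone"
  by (auto simp: sign_cone_def tq_coeff_def of_nat_poly coeff_pCons split: nat.splits)

lemma sign_cone_sum: "(\<And>x. x \<in> A \<Longrightarrow> f x \<in> sign_cone) \<Longrightarrow> sum f A \<in> sign_cone"
  using sign_cone_of_nat[of 0]
  by (induction A rule: infinite_finite_induct) (auto intro: sign_cone_add)

lemma sign_cone_var_t: "var_t \<in> sign_cone"
  by (auto simp: sign_cone_def tq_coeff_def var_t_def coeff_pCons split: nat.splits)

lemma sign_cone_minus_var_q: "- var_q \<in> sign_cone"
  by (auto simp: sign_cone_def tq_coeff_def var_q_def coeff_pCons split: nat.splits)

lemma sign_cone_2t1: "2 * var_t + 1 \<in> sign_cone"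
  using sign_cone_add[OF sign_cone_mult[OF sign_cone_of_nat[of 2] sign_cone_var_t] sign_cone_of_nat[of 1]]
  by simp

lemmas sign_cone_intros = sign_cone_add sign_cone_mult sign_cone_of_nat sign_cone_sum
  sign_cone_var_t sign_cone_minus_var_q sign_cone_2t1

lemma sign_cone_cancel:
  assumes "of_nat n * p \<in> sign_cone" "0 < n"
  shows "p \<in> sign_cone"
  unfolding sign_cone_def mem_Collect_eq
proof (intro allI)
  fix i j
  have "0 \<le> of_nat n * ((-1) ^ j * tq_coeff p i j)"
    using assms(1) unfolding sign_cone_def mem_Collect_eq tq_coeff_of_nat_mult
    by (metis mult.left_commute)
  then show "0 \<le> (-1) ^ j * tq_coeff p i j"
    using assms(2) by (metis of_nat_0_less_iff zero_le_mult_iff not_less)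
qed

lemma tangent_series_sign: "tangent_series hh $ n \<in> sign_cone"
proof (induction n rule: less_induct)
  case (less n)
  show ?case
  proof (cases n)
    case 0
    then show ?thesis
      using hh_odd[of 0] hh_0 sign_cone_var_t by (simp add: tangent_series_def)
  next
    case (Suc m)
    have "of_nat (4 * m + 6) * tangent_series hh $ Suc m \<in> sign_cone"
      unfolding tangent_recurrence using less Suc by (intro sign_cone_intros) auto
    from sign_cone_cancel[OF this] show ?thesis using Suc by simp
  qed
qed

lemma secant_series_sign: "secant_series hh $ n \<in> sign_cone"
proof (induction n rule: less_induct)
  case (less n)
  show ?case
  proof (cases n)
    case 0
    then show ?thesis
      using sign_cone_of_nat[of 1] by (simp add: secant_series_def)
  next
    case (Suc m)
    have "of_nat (4 * Suc m) * secant_series hh $ Suc m \<in> sign_cone"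
      unfolding secant_recurrence using less Suc
      by (intro sign_cone_intros tangent_series_sign) auto
    from sign_cone_cancel[OF this] show ?thesis using Suc by simp
  qed
qed

lemma Z_zigzag_sign: "Z (zigzag n) \<in> sign_cone"
proof (cases "even n")
  case True
  then show ?thesis using secant_series_sign[of "n div 2"]
    by (simp add: Z_eq_ribbon zigzag.rep_eq secant_series_def)
next
  case False
  then show ?thesis using tangent_series_sign[of "n div 2"]
    by (simp add: Z_eq_ribbon zigzag.rep_eq tangent_series_def)
qed


section \<open>Integrality\<close>

definition integral_polys :: "tq_poly set" where
  "integral_polys = {p. \<forall>i j. tq_coeff p i j \<in> \<int>}"

lemma integral_add: "p \<in> integral_polys \<Longrightarrow> r \<in> integral_polys \<Longrightarrow> p + r \<in> integral_polys"
  by (simp add: integral_polys_def tq_coeff_add)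

lemma integral_diff: "p \<in> integral_polys \<Longrightarrow> r \<in> integral_polys \<Longrightarrow> p - r \<in> integral_polys"
  by (simp add: integral_polys_def tq_coeff_diff)

lemma integral_mult: "p \<in> integral_polys \<Longrightarrow> r \<in> integral_polys \<Longrightarrow> p * r \<in> integral_polys"
  by (auto simp: integral_polys_def tq_coeff_mult intro!: Ints_sum Ints_mult)

lemma integral_of_nat: "of_nat n \<in> integral_polys"
  by (auto simp: integral_polys_def tq_coeff_def of_nat_poly coeff_pCons split: nat.splits)

lemma integral_prod: "(\<And>x. x \<in> A \<Longrightarrow> f x \<in> integral_polys) \<Longrightarrow> prod f A \<in> integral_polys"
  using integral_of_nat[of 1]
  by (induction A rule: infinite_finite_induct) (auto intro: integral_mult)

lemma integral_var_t: "var_t \<in> integral_polys"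
  by (auto simp: integral_polys_def tq_coeff_def var_t_def coeff_pCons split: nat.splits)

lemma integral_var_q: "var_q \<in> integral_polys"
  by (auto simp: integral_polys_def tq_coeff_def var_q_def coeff_pCons split: nat.splits)

lemma fact_times_hh_integral: "fact m * hh m \<in> integral_polys"
proof -
  have "of_nat (fact m) * [:[:1 / fact m :: rat:]:] = 1"
    by (simp only: of_nat_poly) (simp add: one_pCons)
  then have "fact m * hh m =
     (\<Prod>i = 1..m div 2. var_t + of_nat i) * (\<Prod>j < (m + 1) div 2. var_t + of_nat j * var_q)"
    unfolding hh_def mult.assoc[symmetric] by simp
  also have "\<dots> \<in> integral_polys"
    by (intro integral_mult integral_prod integral_add integral_var_t integral_var_q integral_of_nat)
  finally show ?thesis .
qed

text \<open>Each product in the recursion absorbs the factorial of the total size by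
  \<open>(a + s)! = binomial(a + s, a) a! s!\<close>.\<close>

lemma fact_times_ribbon_integral: "fact (sum_list xs) * ribbon hh xs \<in> integral_polys"
proof (induction hh xs rule: ribbon.induct)
  case 1
  then show ?case using integral_of_nat[of 1] by simp
next
  case (2 a)
  then show ?case by (simp add: fact_times_hh_integral)
next
  case (3 a b xs)
  let ?s = "sum_list (b # xs)"
  have "fact a * fact ?s * ((a + ?s) choose a) = (fact (a + ?s) :: nat)"
    using binomial_fact_lemma[of a "a + ?s"] by simp
  then have "(fact (a + ?s) :: tq_poly) = fact a * fact ?s * of_nat ((a + ?s) choose a)"
    by (metis of_nat_fact of_nat_mult)
  then have "fact (sum_list (a # b # xs)) * ribbon hh (a # b # xs) =
      of_nat ((a + ?s) choose a) * (fact a * hh a) * (fact ?s * ribbon hh (b # xs))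
      - fact (sum_list ((a + b) # xs)) * ribbon hh ((a + b) # xs)"
    by (simp add: algebra_simps)
  then show ?case
    using integral_diff[OF integral_mult[OF integral_mult[OF integral_of_nat
      fact_times_hh_integral] 3(1)] 3(2)] by (simp only:)
qed

lemma fact_times_Z_zigzag_integral: "fact n * Z (zigzag n) \<in> integral_polys"
proof -
  have "sum_list (parts (zigzag n)) = n"
    by (cases "even n") (simp_all add: zigzag.rep_eq sum_list_replicate odd_two_times_div_two_succ mult.commute)
  then show ?thesis
    using fact_times_ribbon_integral[of "parts (zigzag n)"] by (simp add: Z_eq_ribbon)
qed

theorem theorem4p3:
  fixes n :: nat
  shows "fact n * subst_neg (Z (zigzag n)) \<in> nat_coeff_polys \<and>
    (\<forall>i j. tq_coeff (fact n * Z (zigzag n)) i j \<noteq> 0 \<longrightarrow>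
      sgn (tq_coeff (fact n * Z (zigzag n)) i j) = (-1) ^ j)"
proof (intro conjI allI impI)
  have nonneg: "0 \<le> (-1) ^ j * tq_coeff (fact n * Z (zigzag n)) i j" for i j
    using Z_zigzag_sign[of n]
    by (simp add: sign_cone_def tq_coeff_fact_mult mult.left_commute[of "(-1) ^ _"])
  show "fact n * subst_neg (Z (zigzag n)) \<in> nat_coeff_polys"
    unfolding nat_coeff_polys_def mem_Collect_eq
  proof (intro allI)
    fix i j
    have "tq_coeff (fact n * subst_neg (Z (zigzag n))) i j =
        (-1) ^ j * tq_coeff (fact n * Z (zigzag n)) i j"
      by (simp add: tq_coeff_fact_mult coeff_subst_neg)
    moreover have "(-1) ^ j * tq_coeff (fact n * Z (zigzag n)) i j \<in> \<int>"
      using fact_times_Z_zigzag_integral[of n] by (auto simp: integral_polys_def)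
    ultimately show "tq_coeff (fact n * subst_neg (Z (zigzag n))) i j \<in> \<nat>"
      using nonneg[of j i] by (simp add: Nats_altdef2)
  qed
  show "sgn (tq_coeff (fact n * Z (zigzag n)) i j) = (-1) ^ j"
    if "tq_coeff (fact n * Z (zigzag n)) i j \<noteq> 0" for i j
    using nonneg[of j i] that by (cases "even j") (auto simp: sgn_if)
qed

end
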